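(* Let $K$ be a field and let $A,B$ be two finite subsets of the multiplicative group $K^{*}=K\setminus\{0\}$. Let $A\dot\times B=\{ab : a\in A,\ b\in B,\ a\neq b\}$. Assume that some element $c\in A\dot\times B$ has a unique representation as $c=ab$ with $a\in A$, $b\in B$, $a\neq b$ (that is, there is exactly one pair $(a,b)\in A\times B$ with $a\neq b$ and $ab=c$). Then $|A\dot\times B|\geq |A|+|B|-3$.
   Context: For finite subsets $A,B$ of a multiplicatively written abelian group, the restricted product set is $A\dot\times B=\{ab : a\in A,\ b\in B,\ a\neq b\}$. Only representations $c=ab$ with $a\neq b$ are counted; $c$ may additionally be of the form $d^2$ with $d\in A\cap B$. *)

theory Defs
  imports Complex_Main
begin

definition restricted_prodset :: "'a::ab_semigroup_mult set \<Rightarrow> 'a set \<Rightarrow> 'a set"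
    (infixl "\<times>\<^sub>r" 70) where
  "A \<times>\<^sub>r B = {a * b | a b. a \<in> A \<and> b \<in> B \<and> a \<noteq> b}"

text \<open>Representations are ordered pairs: for \<open>a \<noteq> b\<close> both in \<open>A \<inter> B\<close>, the pairs \<open>(a, b)\<close> and
  \<open>(b, a)\<close> are distinct representations of \<open>a * b\<close>. A representation \<open>c = d * d\<close> is not counted.\<close>

definition restricted_reps ::
    "'a::ab_semigroup_mult set \<Rightarrow> 'a set \<Rightarrow> 'a \<Rightarrow> ('a \<times> 'a) set" where
  "restricted_reps A B c = {(a, b) \<in> A \<times> B. a \<noteq> b \<and> a * b = c}"

end

theory Submission
  imports Defs
begin

text \<open>
  The proof is by the polynomial method. Write \<open>C = A \<times>\<^sub>r B\<close> and let \<open>(a\<^sub>0, b\<^sub>0)\<close> be the unique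
  representation of \<open>c\<close>. In the variables \<open>x = a\<close> and \<open>y = 1 / b\<close>, the polynomial
  \<open>f x y = (x * y - 1) * (\<Prod>d\<in>C - {c}. x - d * y)\<close> vanishes at every point of \<open>A \<times> B\<^sup>-\<^sup>1\<close> other than
  \<open>(a\<^sub>0, 1 / b\<^sub>0)\<close>: the first factor takes care of the pairs with \<open>a = b\<close>, and the factor for
  \<open>d = a * b\<close> of those with \<open>a \<noteq> b\<close>, except when \<open>a * b = c\<close>, where the representation is unique.
  At \<open>(a\<^sub>0, 1 / b\<^sub>0)\<close> no factor vanishes. Passing to \<open>1 / b\<close> is the crucial point: the condition
  \<open>a * b = d\<close> becomes homogeneous linear, at the price of a quadratic factor for \<open>a = b\<close>, so that
  \<open>f\<close> has total degree only \<open>card C + 1\<close>.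

  On the other hand, a polynomial that is nonzero at exactly one point of a grid of size \<open>m \<times> n\<close> has
  total degree at least \<open>(m - 1) + (n - 1)\<close>. Hence \<open>card C + 1 \<ge> card A + card B - 2\<close>, which is
  the claim. The degree bound is obtained by duality: an \<open>m\<close>-point set carries a weight that
  annihilates all powers below \<open>m - 1\<close> and is nonzero at a prescribed point
  (\<open>annihilating_weight_exists\<close>). The product of two such weights annihilates
  every polynomial of total degree below \<open>(m - 1) + (n - 1)\<close> (\<open>product_weight_annihilates\<close>), but
  it cannot annihilate a function supported at the one point where it is nonzero.
\<close>

text \<open>
  The coefficients \<open>w a = 1 / (\<Prod>a'\<in>A - {a}. a - a')\<close> of the divided difference
  form such a weight. Building it by
  adding one point \<open>b\<close> at a time makes the vanishing of the moments immediate: dividing the old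
  weights by \<open>a - b\<close> turns the old moment of order \<open>i\<close> into the combination
  \<open>S (Suc i) - b * S i\<close> of new moments, and the weight at \<open>b\<close> is free to make \<open>S 0\<close> vanish.
\<close>

lemma annihilating_weight_exists:
  fixes A :: "'k::field set"
  assumes "finite A" and "a\<^sub>0 \<in> A"
  shows "\<exists>w. w a\<^sub>0 \<noteq> 0 \<and> (\<forall>i < card A - 1. (\<Sum>a\<in>A. w a * a ^ i) = 0)"
proof -
  have "\<exists>w. w a\<^sub>0 \<noteq> 0 \<and> (\<forall>i < card F. (\<Sum>a\<in>insert a\<^sub>0 F. w a * a ^ i) = 0)"
    if "finite F" and "F \<subseteq> - {a\<^sub>0}" for F
    using that
  proof (induction rule: finite_subset_induct)
    case empty
    show ?case by (intro exI[of _ "\<lambda>_. 1"]) simp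
  next
    case (insert b F)
    let ?E = "insert a\<^sub>0 F"
    obtain w where w0: "w a\<^sub>0 \<noteq> 0" and w: "\<And>i. i < card F \<Longrightarrow> (\<Sum>a\<in>?E. w a * a ^ i) = 0"
      using insert.IH by blast
    have fin: "finite ?E" and b: "b \<notin> ?E" "b \<noteq> a\<^sub>0" using insert.hyps by auto
    define v where "v a = (if a = b then - (\<Sum>e\<in>?E. w e / (e - b)) else w a / (a - b))" for a
    have v_off: "v a = w a / (a - b)" if "a \<in> ?E" for a using that b by (auto simp: v_def)
    define S where "S i = (\<Sum>a\<in>insert b ?E. v a * a ^ i)" for i
    have S_0: "S 0 = 0"
      unfolding S_def sum.insert[OF fin b(1)] using v_off by (simp add: v_def[of b])
    have S_Suc: "S (Suc i) = b * S i" if "i < card F" for i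
    proof -
      have "S (Suc i) - b * S i = (\<Sum>a\<in>insert b ?E. v a * (a - b) * a ^ i)"
        unfolding S_def by (simp add: sum_distrib_left flip: sum_subtractf)
          (simp add: algebra_simps)
      also have "\<dots> = (\<Sum>a\<in>?E. v a * (a - b) * a ^ i)"
        by (simp only: sum.insert[OF fin b(1)]) simp
      also have "\<dots> = (\<Sum>a\<in>?E. w a * a ^ i)"
      proof (rule sum.cong[OF refl])
        fix a assume "a \<in> ?E"
        then have "a - b \<noteq> 0" using b by auto
        with v_off[OF \<open>a \<in> ?E\<close>] show "v a * (a - b) * a ^ i = w a * a ^ i" by simp
      qed
      finally show ?thesis using w[OF that] by simp
    qed
    have "S i = 0" if "i < Suc (card F)" for i
      using that by (induction i) (simp_all add: S_0 S_Suc)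
    moreover have "v a\<^sub>0 \<noteq> 0" using w0 b by (simp add: v_def)
    ultimately show ?case
      using insert.hyps by (intro exI[of _ v]) (simp add: S_def insert_commute)
  qed
  from this[of "A - {a\<^sub>0}"] show ?thesis using assms by (auto simp: insert_absorb)
qed

text \<open>
  For a monomial, the double sum is a product of two moments, one of which has low order. Each
  factor \<open>x - d * y\<close> splits the sum into two with one factor fewer and the degree of the monomial
  one larger, so the total degree \<open>i + j + card D\<close> is preserved.
\<close>

lemma product_weight_annihilates:
  fixes w u :: "'k::field \<Rightarrow> 'k"
  assumes "finite D"
    and w: "\<And>i. i < m \<Longrightarrow> (\<Sum>x\<in>X. w x * x ^ i) = 0"
    and u: "\<And>j. j < n \<Longrightarrow> (\<Sum>y\<in>Y. u y * y ^ j) = 0"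
    and "i + j + card D < m + n"
  shows "(\<Sum>x\<in>X. \<Sum>y\<in>Y. w x * u y * (x ^ i * y ^ j * (\<Prod>d\<in>D. x - d * y))) = 0"
  using assms(1,4)
proof (induction D arbitrary: i j)
  case empty
  have "(\<Sum>x\<in>X. \<Sum>y\<in>Y. w x * u y * (x ^ i * y ^ j))
      = (\<Sum>x\<in>X. w x * x ^ i) * (\<Sum>y\<in>Y. u y * y ^ j)"
    unfolding sum_product by (intro sum.cong refl) (simp add: mult_ac)
  moreover have "i < m \<or> j < n" using empty by auto
  ultimately show ?case using w u by auto
next
  case (insert e D)
  let ?L = "\<lambda>i j. \<Sum>x\<in>X. \<Sum>y\<in>Y. w x * u y * (x ^ i * y ^ j * (\<Prod>d\<in>D. x - d * y))"
  have "(\<Sum>x\<in>X. \<Sum>y\<in>Y. w x * u y * (x ^ i * y ^ j * (\<Prod>d\<in>insert e D. x - d * y)))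
      = ?L (Suc i) j - e * ?L i (Suc j)"
    using insert.hyps
    by (simp add: sum_distrib_left flip: sum_subtractf) (simp add: algebra_simps)
  also have "\<dots> = 0"
    using insert.IH[of "Suc i" j] insert.IH[of i "Suc j"] insert.prems insert.hyps by simp
  finally show ?case .
qed

theorem theorem5:
  fixes A B :: "'k::field set" and c :: 'k
  assumes "finite A" and "finite B"
    and "A \<subseteq> UNIV - {0}" and "B \<subseteq> UNIV - {0}"
    and "c \<in> A \<times>\<^sub>r B"
    and "\<exists>!p. p \<in> restricted_reps A B c"
  shows "int (card (A \<times>\<^sub>r B)) \<ge> int (card A) + int (card B) - 3"
proof (rule ccontr)
  assume small: "\<not> ?thesis"
  define C where "C = A \<times>\<^sub>r B"
  define D where "D = C - {c}"
  obtain a\<^sub>0 b\<^sub>0 where rep: "(a\<^sub>0, b\<^sub>0) \<in> restricted_reps A B c"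
    and unique: "\<And>p. p \<in> restricted_reps A B c \<Longrightarrow> p = (a\<^sub>0, b\<^sub>0)"
    using assms(6) by (metis surj_pair)
  have ab: "a\<^sub>0 \<in> A" "b\<^sub>0 \<in> B" "a\<^sub>0 \<noteq> b\<^sub>0" "a\<^sub>0 * b\<^sub>0 = c"
    using rep by (auto simp: restricted_reps_def)
  have nz: "b \<noteq> 0" if "b \<in> B" for b using that assms(4) by auto
  have "C \<subseteq> (\<lambda>(a, b). a * b) ` (A \<times> B)" by (auto simp: C_def restricted_prodset_def)
  then have finC: "finite C" using assms(1,2) by (meson finite_SigmaI finite_imageI finite_subset)
  then have finD: "finite D" by (simp add: D_def)
  have cardC: "card C = Suc (card D)"
    using card_Suc_Diff1[OF finC] assms(5) by (simp add: D_def C_def)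
  let ?Y = "inverse ` B"
  have finY: "finite ?Y" and cardY: "card ?Y = card B"
    using assms(2) by (auto simp: card_image inj_on_def)

  obtain w where w0: "w a\<^sub>0 \<noteq> 0" and w: "\<And>i. i < card A - 1 \<Longrightarrow> (\<Sum>a\<in>A. w a * a ^ i) = 0"
    using annihilating_weight_exists[OF assms(1) ab(1)] by blast
  obtain u where u0: "u (inverse b\<^sub>0) \<noteq> 0"
    and u: "\<And>j. j < card B - 1 \<Longrightarrow> (\<Sum>y\<in>?Y. u y * y ^ j) = 0"
    using annihilating_weight_exists[OF finY imageI[OF ab(2)]] unfolding cardY by blast

  define g where "g x y = (\<Prod>d\<in>D. x - d * y)" for x y
  define f where "f x y = (x * y - 1) * g x y" for x y

  have "card A > 0" "card B > 0" using ab assms(1,2) by (auto simp: card_gt_0_iff)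
  then have deg: "2 + card D < (card A - 1) + (card B - 1)"
    using small cardC unfolding C_def by linarith
  have annihilates: "(\<Sum>x\<in>A. \<Sum>y\<in>?Y. w x * u y * (x ^ i * y ^ j * g x y)) = 0"
    if "i + j + card D < (card A - 1) + (card B - 1)" for i j
    unfolding g_def
    by (rule product_weight_annihilates[where X = A and Y = ?Y and w = w and u = u,
          OF finD w u that])
  have "(\<Sum>x\<in>A. \<Sum>y\<in>?Y. w x * u y * f x y)
      = (\<Sum>x\<in>A. \<Sum>y\<in>?Y. w x * u y * (x ^ 1 * y ^ 1 * g x y))
        - (\<Sum>x\<in>A. \<Sum>y\<in>?Y. w x * u y * (x ^ 0 * y ^ 0 * g x y))"
    unfolding f_def by (simp add: algebra_simps flip: sum_subtractf)
  also have "\<dots> = 0"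
    using annihilates[of 1 1] annihilates[of 0 0] deg by simp
  finally have sum_0: "(\<Sum>x\<in>A. \<Sum>y\<in>?Y. w x * u y * f x y) = 0" .

  have f_vanishes: "f a (inverse b) = 0" if "a \<in> A" "b \<in> B" "(a, b) \<noteq> (a\<^sub>0, b\<^sub>0)" for a b
  proof (cases "a = b")
    case True
    then show ?thesis using nz[OF that(2)] by (simp add: f_def)
  next
    case False
    then have "a * b \<in> C" using that by (auto simp: C_def restricted_prodset_def)
    moreover have "a * b \<noteq> c"
      using unique[of "(a, b)"] that False by (auto simp: restricted_reps_def)
    ultimately have "a * b \<in> D" by (simp add: D_def)
    moreover have "a - (a * b) * inverse b = 0" using nz[OF that(2)] by simp
    ultimately have "\<exists>d\<in>D. a - d * inverse b = 0" by (rule rev_bexI)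
    then have "g a (inverse b) = 0" unfolding g_def by (rule prod_zero[OF finD])
    then show ?thesis by (simp add: f_def)
  qed
  have f_point: "f a\<^sub>0 (inverse b\<^sub>0) \<noteq> 0"
  proof -
    have "a\<^sub>0 - d * inverse b\<^sub>0 \<noteq> 0" if "d \<in> D" for d
      using that ab nz[OF ab(2)] by (auto simp: D_def field_simps)
    then have "g a\<^sub>0 (inverse b\<^sub>0) \<noteq> 0" using finD by (simp add: g_def)
    moreover have "a\<^sub>0 * inverse b\<^sub>0 - 1 \<noteq> 0" using ab nz[OF ab(2)] by (simp add: field_simps)
    ultimately show ?thesis by (simp add: f_def)
  qed

  have "(\<Sum>x\<in>A. \<Sum>y\<in>?Y. w x * u y * f x y)
      = (\<Sum>p\<in>A \<times> ?Y. w (fst p) * u (snd p) * f (fst p) (snd p))"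
    by (simp add: sum.cartesian_product case_prod_beta)
  also have "\<dots> = (\<Sum>p\<in>{(a\<^sub>0, inverse b\<^sub>0)}. w (fst p) * u (snd p) * f (fst p) (snd p))"
    using assms(1) finY ab
    by (intro sum.mono_neutral_right) (auto, (metis Pair_inject f_vanishes)+)
  also have "\<dots> \<noteq> 0" using w0 u0 f_point by simp
  finally show False using sum_0 by simp
qed

end
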